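(* Let $X,Y$ be finite simple graphs. If $X$ is vertex transitive, then $$ \alpha(X\ltimes Y)\le|V(X)|\frac{\alpha(\bar Y)}{\alpha(\bar X)},\quad \theta_S(X\ltimes Y)\le|V(X)|\frac{\theta_S(\bar Y)}{\theta_S(\bar X)},\quad \theta_L(X\ltimes Y)\le|V(X)|\frac{\theta_L(\bar Y)}{\theta_L(\bar X)}=\theta_L(X)\theta_L(\bar Y). $$ If $Y$ is vertex transitive, then $$ \alpha(X\ltimes Y)\le|V(Y)|\frac{\alpha(X)}{\alpha(Y)},\quad \theta_S(X\ltimes Y)\le|V(Y)|\frac{\theta_S(X)}{\theta_S(Y)},\quad \theta_L(X\ltimes Y)\le|V(Y)|\frac{\theta_L(X)}{\theta_L(Y)}=\theta_L(X)\theta_L(\bar Y). $$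
   Context: $\alpha(G)$ denotes the independence number of $G$; $\bar G$ is the complement of $G$. $\theta_S(G)=\max\{\mathrm{tr}(JM): \mathrm{tr}M=1,\ M\succeq0,\ M_{v,v'}=0 \text{ whenever } v\sim v',\ M_{v,v'}\ge0\ \forall v,v'\}$ and $\theta_L(G)=\max\{\mathrm{tr}(JM): \mathrm{tr}M=1,\ M\succeq0,\ M_{v,v'}=0 \text{ whenever } v\sim v'\}$, where $M$ ranges over real symmetric $|V(G)|\times|V(G)|$ matrices and $J$ is the all-ones matrix (Schrijver and Lovász $\theta$-functions). The homomorphic product $X\ltimes Y$ is the simple graph on $V(X)\times V(Y)$ in which distinct $(x_1,y_1),(x_2,y_2)$ are adjacent iff $x_1=x_2$, or $x_1\sim x_2$ in $X$ and $y_1,y_2$ are not adjacent in $Y$ (possibly $y_1=y_2$). *)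

theory Defs
  imports "HOL-Analysis.Analysis"
begin

text \<open>
  A graph on the vertex set \<^term>\<open>UNIV :: 'v set\<close>, with \<open>'v\<close> a finite type, is given by its
  adjacency relation.
\<close>

definition simple_graph :: "('v \<Rightarrow> 'v \<Rightarrow> bool) \<Rightarrow> bool" where
  "simple_graph G \<longleftrightarrow> symp G \<and> irreflp G"

definition complement :: "('v \<Rightarrow> 'v \<Rightarrow> bool) \<Rightarrow> 'v \<Rightarrow> 'v \<Rightarrow> bool" where
  "complement G u v \<longleftrightarrow> u \<noteq> v \<and> \<not> G u v"

definition hom_product ::
    "('a \<Rightarrow> 'a \<Rightarrow> bool) \<Rightarrow> ('b \<Rightarrow> 'b \<Rightarrow> bool) \<Rightarrow> 'a \<times> 'b \<Rightarrow> 'a \<times> 'b \<Rightarrow> bool"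
    (infixl "\<ltimes>" 70) where
  "(X \<ltimes> Y) p q \<longleftrightarrow>
     p \<noteq> q \<and> (fst p = fst q \<or> X (fst p) (fst q) \<and> \<not> Y (snd p) (snd q))"

definition automorphism :: "('v \<Rightarrow> 'v \<Rightarrow> bool) \<Rightarrow> ('v \<Rightarrow> 'v) \<Rightarrow> bool" where
  "automorphism G f \<longleftrightarrow> bij f \<and> (\<forall>u v. G (f u) (f v) \<longleftrightarrow> G u v)"

definition vertex_transitive :: "('v \<Rightarrow> 'v \<Rightarrow> bool) \<Rightarrow> bool" where
  "vertex_transitive G \<longleftrightarrow> (\<forall>u v. \<exists>f. automorphism G f \<and> f u = v)"

definition independent_set :: "('v \<Rightarrow> 'v \<Rightarrow> bool) \<Rightarrow> 'v set \<Rightarrow> bool" where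
  "independent_set G S \<longleftrightarrow> (\<forall>u\<in>S. \<forall>v\<in>S. \<not> G u v)"

definition independence_number :: "('v::finite \<Rightarrow> 'v \<Rightarrow> bool) \<Rightarrow> nat" where
  "independence_number G = Max {card S |S. independent_set G S}"

definition psd :: "real^'v^'v \<Rightarrow> bool" where
  "psd M \<longleftrightarrow> transpose M = M \<and> (\<forall>x. 0 \<le> x \<bullet> (M *v x))"

definition all_ones :: "real^'v^'v" where
  "all_ones = (\<chi> u v. 1)"

definition theta_L_feasible :: "('v::finite \<Rightarrow> 'v \<Rightarrow> bool) \<Rightarrow> (real^'v^'v) set" where
  "theta_L_feasible G = {M. trace M = 1 \<and> psd M \<and> (\<forall>u v. G u v \<longrightarrow> M $ u $ v = 0)}"

definition theta_S_feasible :: "('v::finite \<Rightarrow> 'v \<Rightarrow> bool) \<Rightarrow> (real^'v^'v) set" where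
  "theta_S_feasible G =
     {M. trace M = 1 \<and> psd M \<and> (\<forall>u v. G u v \<longrightarrow> M $ u $ v = 0) \<and> (\<forall>u v. 0 \<le> M $ u $ v)}"

text \<open>
  The suprema below are attained for irreflexive \<open>G\<close>, see \<open>theta_L_attained\<close> and
  \<open>theta_S_attained\<close>, so they are maxima.
\<close>

definition theta_L :: "('v::finite \<Rightarrow> 'v \<Rightarrow> bool) \<Rightarrow> real" where
  "theta_L G = (SUP M\<in>theta_L_feasible G. trace (all_ones ** M))"

definition theta_S :: "('v::finite \<Rightarrow> 'v \<Rightarrow> bool) \<Rightarrow> real" where
  "theta_S G = (SUP M\<in>theta_S_feasible G. trace (all_ones ** M))"

lemma psd_entry_bound:
  fixes M :: "real^'v^'v"
  assumes "psd M" "trace M = 1"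
  shows "\<bar>M $ u $ v\<bar> \<le> 1"
proof -
  have sym: "M $ a $ b = M $ b $ a" for a b
    using assms(1) unfolding psd_def transpose_def by (metis vec_lambda_beta)
  have ax: "axis a 1 \<bullet> (M *v axis b 1) = M $ a $ b" for a b
    by (simp add: inner_axis' matrix_vector_mult_basis column_def)
  have pos: "0 \<le> M $ a $ a" for a
    using assms(1) ax[of a a] unfolding psd_def by metis
  have le1: "M $ a $ a \<le> 1" for a
  proof -
    have "M $ a $ a \<le> (\<Sum>i\<in>UNIV. M $ i $ i)"
      by (rule member_le_sum) (auto simp: pos)
    then show ?thesis using assms(2) by (simp add: trace_def)
  qed
  have "0 \<le> (axis u 1 + axis v 1) \<bullet> (M *v (axis u 1 + axis v 1))"
    using assms(1) unfolding psd_def by blast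
  then have p: "0 \<le> M $ u $ u + M $ v $ v + 2 * M $ u $ v"
    by (simp add: matrix_vector_right_distrib inner_add_left inner_add_right ax sym[of v u])
  have "0 \<le> (axis u 1 - axis v 1) \<bullet> (M *v (axis u 1 - axis v 1))"
    using assms(1) unfolding psd_def by blast
  then have m: "0 \<le> M $ u $ u + M $ v $ v - 2 * M $ u $ v"
    by (simp add: matrix_vector_mult_diff_distrib inner_diff_left inner_diff_right ax sym[of v u])
  show ?thesis using p m le1[of u] le1[of v] by linarith
qed

lemma closed_psd: "closed {M :: real^'v^'v. psd M}"
proof -
  have "{M :: real^'v^'v. psd M} =
      (\<Inter>u. \<Inter>v. {M. M $ v $ u = M $ u $ v}) \<inter>
      (\<Inter>x. {M. 0 \<le> (\<Sum>i\<in>UNIV. x $ i * (\<Sum>j\<in>UNIV. M $ i $ j * x $ j))})"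
    by (auto simp: psd_def transpose_def vec_eq_iff inner_vec_def matrix_vector_mult_def)
  also have "closed \<dots>"
    by (intro closed_Int closed_INT ballI closed_Collect_eq closed_Collect_le continuous_intros)
  finally show ?thesis .
qed

lemma compact_theta_L_feasible: "compact (theta_L_feasible G)"
proof -
  have "theta_L_feasible G = {M. (\<Sum>i\<in>UNIV. M $ i $ i) = 1} \<inter> {M. psd M} \<inter>
      (\<Inter>u. \<Inter>v\<in>{v. G u v}. {M. M $ u $ v = 0})"
    by (auto simp: theta_L_feasible_def trace_def)
  also have "closed \<dots>"
    by (intro closed_Int closed_INT ballI closed_psd closed_Collect_eq continuous_intros)
  finally have "closed (theta_L_feasible G)" .
  moreover have "bounded (theta_L_feasible G)"
  proof (rule boundedI)
    fix M assume M: "M \<in> theta_L_feasible G"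
    have "norm M \<le> (\<Sum>u\<in>UNIV. norm (M $ u))"
      by (simp add: norm_vec_def L2_set_le_sum)
    also have "\<dots> \<le> (\<Sum>u\<in>UNIV. \<Sum>v\<in>UNIV. \<bar>M $ u $ v\<bar>)"
      by (intro sum_mono norm_le_l1_cart)
    also have "\<dots> \<le> (\<Sum>u\<in>(UNIV::'a set). \<Sum>v\<in>(UNIV::'a set). 1)"
      using M by (intro sum_mono psd_entry_bound) (auto simp: theta_L_feasible_def)
    finally show "norm M \<le> (\<Sum>u\<in>(UNIV::'a set). \<Sum>v\<in>(UNIV::'a set). 1)" .
  qed
  ultimately show ?thesis by (simp add: compact_eq_bounded_closed)
qed

lemma compact_theta_S_feasible: "compact (theta_S_feasible G)"
proof -
  have "theta_S_feasible G = theta_L_feasible G \<inter> (\<Inter>u. \<Inter>v. {M. 0 \<le> M $ u $ v})"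
    by (auto simp: theta_S_feasible_def theta_L_feasible_def)
  moreover have "closed (\<Inter>u. \<Inter>v. {M :: real^'a^'a. 0 \<le> M $ u $ v})"
    by (intro closed_INT ballI closed_Collect_le continuous_intros)
  ultimately show ?thesis by (simp add: compact_Int_closed compact_theta_L_feasible)
qed

lemma theta_S_feasible_nonempty:
  assumes "irreflp G"
  shows "theta_S_feasible G \<noteq> {}"
proof -
  define M :: "real^'a^'a" where "M = (\<chi> u v. if u = v then 1 / real CARD('a) else 0)"
  have Mv: "(M *v x) $ i = x $ i / real CARD('a)" for x i
    by (simp add: M_def matrix_vector_mult_def if_distrib[of "\<lambda>a. a * _"] cong: if_cong)
  have "psd M"
    unfolding psd_def
  proof (intro conjI allI)
    show "transpose M = M" by (auto simp: transpose_def M_def vec_eq_iff)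
    show "0 \<le> x \<bullet> (M *v x)" for x by (auto simp: inner_vec_def Mv intro!: sum_nonneg)
  qed
  moreover have "trace M = 1" by (simp add: trace_def M_def)
  ultimately have "M \<in> theta_S_feasible G"
    using assms by (auto simp: theta_S_feasible_def M_def irreflp_def)
  then show ?thesis by blast
qed

lemma theta_feasible_subset: "theta_S_feasible G \<subseteq> theta_L_feasible G"
  by (auto simp: theta_S_feasible_def theta_L_feasible_def)

lemma SUP_attained:
  fixes F :: "(real^'v^'v) set"
  assumes "compact F" "F \<noteq> {}"
  shows "\<exists>M\<in>F. (SUP N\<in>F. trace (all_ones ** N)) = trace (all_ones ** M) \<and>
    (\<forall>N\<in>F. trace (all_ones ** N) \<le> trace (all_ones ** M))"
proof -
  have "continuous_on F (\<lambda>M::real^'v^'v. trace (all_ones ** M))"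
    unfolding trace_def matrix_matrix_mult_def all_ones_def by (simp, intro continuous_intros)
  from continuous_attains_sup[OF assms this]
  obtain M where M: "M \<in> F" "\<forall>N\<in>F. trace (all_ones ** N) \<le> trace (all_ones ** M)" by blast
  then have "(SUP N\<in>F. trace (all_ones ** N)) = trace (all_ones ** M)"
    by (intro cSup_eq_maximum) auto
  with M show ?thesis by blast
qed

lemma theta_L_attained:
  assumes "irreflp G"
  shows "\<exists>M\<in>theta_L_feasible G. theta_L G = trace (all_ones ** M) \<and>
    (\<forall>N\<in>theta_L_feasible G. trace (all_ones ** N) \<le> trace (all_ones ** M))"
  unfolding theta_L_def
  using SUP_attained[OF compact_theta_L_feasible] theta_S_feasible_nonempty[OF assms]
    theta_feasible_subset by blast

lemma theta_S_attained:
  assumes "irreflp G"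
  shows "\<exists>M\<in>theta_S_feasible G. theta_S G = trace (all_ones ** M) \<and>
    (\<forall>N\<in>theta_S_feasible G. trace (all_ones ** N) \<le> trace (all_ones ** M))"
  unfolding theta_S_def
  using SUP_attained[OF compact_theta_S_feasible] theta_S_feasible_nonempty[OF assms] by blast

end

theory Submission
  imports Defs
begin

text \<open>
  Let \<open>T\<close> be vertex transitive on \<open>n\<close> vertices, \<open>N\<close> optimal for \<open>\<theta>(T)\<close> and \<open>M\<close> optimal for
  \<open>\<theta>(H)\<close>. Averaging \<open>N\<close> over the automorphisms of \<open>T\<close> makes its diagonal and its row sums constant,
  so that \<open>N - (\<theta>(T) / n\<^sup>2) J\<close> is still positive semidefinite. Given maps \<open>f : V(H) \<rightarrow> V(T)\<close> and
  \<open>g : V(H) \<rightarrow> V(K)\<close>, the Schur product of \<open>M\<close> with the pullback of \<open>N\<close> along \<open>f\<close>, summed over the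
  fibres of \<open>g\<close>, is positive semidefinite and has entry sum at least \<open>\<theta>(T) \<theta>(H) / n\<^sup>2\<close>. If every pair
  of distinct vertices of \<open>H\<close> that \<open>g\<close> identifies or maps to an edge of \<open>K\<close> is an edge of \<open>H\<close> or is
  mapped by \<open>f\<close> to an edge of \<open>T\<close>, then it has trace \<open>1 / n\<close> and vanishes on the edges of \<open>K\<close>, and
  therefore \<open>\<theta>(T) \<theta>(H) \<le> n \<theta>(K)\<close>. The projections of \<open>X \<ltimes> Y\<close> satisfy this condition with
  \<open>T = complement X\<close>, \<open>K = complement Y\<close>, and with \<open>T = Y\<close>, \<open>K = X\<close>; a one-vertex \<open>K\<close> gives
  \<open>\<theta>\<^sub>L(X) \<theta>\<^sub>L(complement X) \<le> n\<close>. The reverse of the last inequality holds for every graph: for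
  \<open>t > \<theta>\<^sub>L(X)\<close> a separating hyperplane yields \<open>A\<close> supported on the edges of \<open>X\<close> such that
  \<open>t I + A - J\<close> is positive semidefinite, and then \<open>(t I + A) / (t n)\<close> is feasible for the complement.
\<close>

subsection \<open>Positive semidefinite kernels\<close>

text \<open>Kernels are functions rather than matrices so that pulling back along a map of vertices
  is plain composition. The link to \<open>psd\<close> is \<open>psd_iff_psd_kernel\<close>.\<close>

definition psd_kernel :: "('v::finite \<Rightarrow> 'v \<Rightarrow> real) \<Rightarrow> bool" where
  "psd_kernel K \<longleftrightarrow> (\<forall>u v. K u v = K v u) \<and>
     (\<forall>x. 0 \<le> (\<Sum>u\<in>UNIV. \<Sum>v\<in>UNIV. K u v * x u * x v))"

lemma psd_kernel_sym: "psd_kernel K \<Longrightarrow> K u v = K v u"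
  by (simp add: psd_kernel_def)

lemma psd_kernel_quad:
  "psd_kernel K \<Longrightarrow> 0 \<le> (\<Sum>u\<in>UNIV. \<Sum>v\<in>UNIV. K u v * x u * x v)"
  by (simp add: psd_kernel_def)

text \<open>This is the quadratic form evaluated at \<open>x\<close> plus \<open>a\<close> times the
  unit vector at \<open>u\<close>, expanded in powers of \<open>a\<close>. Choices of
  \<open>x\<close> and \<open>a\<close> give the diagonal bound, the zero-row property and the Schur
  complement.\<close>

lemma psd_kernel_shift:
  assumes "psd_kernel K"
  shows "0 \<le> (\<Sum>p\<in>UNIV. \<Sum>q\<in>UNIV. K p q * x p * x q) + 2 * a * (\<Sum>q\<in>UNIV. K u q * x q) + a\<^sup>2 * K u u"
proof -
  let ?d = "\<lambda>p. if p = u then a else 0"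
  have "0 \<le> (\<Sum>p\<in>UNIV. \<Sum>q\<in>UNIV. K p q * (x p + ?d p) * (x q + ?d q))"
    using psd_kernel_quad[OF assms, of "\<lambda>p. x p + ?d p"] .
  also have "\<dots> = (\<Sum>p\<in>UNIV. \<Sum>q\<in>UNIV. K p q * x p * x q)
      + (\<Sum>p\<in>UNIV. \<Sum>q\<in>UNIV. K p q * x p * ?d q)
      + (\<Sum>p\<in>UNIV. \<Sum>q\<in>UNIV. K p q * x q * ?d p)
      + (\<Sum>p\<in>UNIV. \<Sum>q\<in>UNIV. K p q * ?d p * ?d q)"
    unfolding sum.distrib[symmetric] by (simp add: distrib_left distrib_right mult_ac add_ac)
  also have "(\<Sum>p\<in>UNIV. \<Sum>q\<in>UNIV. K p q * x p * ?d q) = a * (\<Sum>q\<in>UNIV. K u q * x q)"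
    by (simp add: sum_distrib_left mult_ac psd_kernel_sym[OF assms, of _ u] if_distrib[of "\<lambda>c. _ * c"] cong: if_cong)
  also have "(\<Sum>p\<in>UNIV. \<Sum>q\<in>UNIV. K p q * x q * ?d p) = a * (\<Sum>q\<in>UNIV. K u q * x q)"
    by (subst sum.swap) (simp add: sum_distrib_left mult_ac if_distrib[of "\<lambda>c. _ * c"] cong: if_cong)
  also have "(\<Sum>p\<in>UNIV. \<Sum>q\<in>UNIV. K p q * ?d p * ?d q) = a\<^sup>2 * K u u"
  proof -
    have "K p q * ?d p * ?d q = (if q = u then if p = u then a\<^sup>2 * K u u else 0 else 0)" for p q
      by (simp add: power2_eq_square)
    then show ?thesis by simp
  qed
  finally show ?thesis by simp
qed

lemma psd_kernel_diag_nonneg: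
  assumes "psd_kernel K"
  shows "0 \<le> K u u"
  using psd_kernel_shift[OF assms, of "\<lambda>_. 0" 1 u] by simp

text \<open>With \<open>K u u = 0\<close>, the form at the unit vector of \<open>v\<close> plus
  \<open>a\<close> times that of \<open>u\<close> is affine in \<open>a\<close>; being nonnegative
  for all \<open>a\<close>, it has slope zero.\<close>

lemma psd_kernel_zero_row:
  assumes "psd_kernel K" "K u u = 0"
  shows "K u v = 0"
proof (rule ccontr)
  assume nz: "K u v \<noteq> 0"
  have "0 \<le> K v v + 2 * a * K u v" for a
    using psd_kernel_shift[OF assms(1), of "\<lambda>w. if w = v then 1 else 0" a u] assms(2)
    by (simp add: if_distrib[of "\<lambda>c. _ * c"] cong: if_cong)
  \<comment> \<open>For this \<open>a\<close> the expression equals -1.\<close>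
  from this[of "- (K v v + 1) / (2 * K u v)"] nz show False by (simp add: field_simps)
qed

text \<open>One Cholesky step per induction step: subtracting the rank-one kernel of row
  \<open>u\<close>, divided by the pivot \<open>K u u\<close>, leaves a psd Schur complement with
  fewer nonzero diagonal entries. The subtracted term supplies the last Gram vector.\<close>

lemma psd_kernel_gram:
  fixes K :: "'v::finite \<Rightarrow> 'v \<Rightarrow> real"
  assumes "psd_kernel K"
  shows "\<exists>(m::nat) w. \<forall>u v. K u v = (\<Sum>k<m. w k u * w k v)"
  using assms
proof (induction "card {u. K u u \<noteq> 0}" arbitrary: K rule: less_induct)
  case less
  note psd = less.prems
  show ?case
  proof (cases "\<exists>u. K u u \<noteq> 0")
    case False
    then have "K u v = 0" for u v using psd_kernel_zero_row[OF psd] by blast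
    then show ?thesis by (intro exI[of _ 0]) simp
  next
    case True
    then obtain u where u: "K u u \<noteq> 0" by blast
    then have pos: "K u u > 0" using psd_kernel_diag_nonneg[OF psd, of u] by linarith
    define L where "L p q = K p q - K u p * K u q / K u u" for p q
    have L: "psd_kernel L"
      unfolding psd_kernel_def
    proof (intro conjI allI)
      show "L p q = L q p" for p q by (simp add: L_def psd_kernel_sym[OF psd, of p q])
      fix x :: "'v \<Rightarrow> real"
      let ?s = "\<Sum>q\<in>UNIV. K u q * x q"
      have "(\<Sum>p\<in>UNIV. \<Sum>q\<in>UNIV. L p q * x p * x q)
          = (\<Sum>p\<in>UNIV. \<Sum>q\<in>UNIV. K p q * x p * x q) - ?s * ?s / K u u"
        unfolding sum_product sum_divide_distrib sum_subtractf[symmetric]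
        by (intro sum.cong refl) (simp add: L_def algebra_simps)
      \<comment> \<open>The value \<open>- ?s / K u u\<close> minimises the quadratic in
        \<open>a\<close> from \<open>psd_kernel_shift\<close>.\<close>
      moreover have "0 \<le> (\<Sum>p\<in>UNIV. \<Sum>q\<in>UNIV. K p q * x p * x q) - ?s * ?s / K u u"
        using psd_kernel_shift[OF psd, of x "- ?s / K u u" u] pos
        by (simp add: power2_eq_square)
      ultimately show "0 \<le> (\<Sum>p\<in>UNIV. \<Sum>q\<in>UNIV. L p q * x p * x q)" by simp
    qed
    \<comment> \<open>The entry at \<open>u\<close> becomes zero, and old zeros persist because a
      zero on the diagonal of \<open>K\<close> annihilates its whole row.\<close>
    have "{p. L p p \<noteq> 0} \<subset> {p. K p p \<noteq> 0}"
    proof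
      show "{p. L p p \<noteq> 0} \<subseteq> {p. K p p \<noteq> 0}"
      proof safe
        fix p assume "K p p = 0" "L p p \<noteq> 0"
        then show False using psd_kernel_zero_row[OF psd, of p u] psd_kernel_sym[OF psd, of u p]
          by (simp add: L_def)
      qed
      have "L u u = 0" using u by (simp add: L_def)
      then show "{p. L p p \<noteq> 0} \<noteq> {p. K p p \<noteq> 0}" using u by blast
    qed
    then have "card {p. L p p \<noteq> 0} < card {p. K p p \<noteq> 0}" by (intro psubset_card_mono) auto
    from less.hyps[OF this L] obtain m :: nat and w
      where w: "\<And>p q. L p q = (\<Sum>k<m. w k p * w k q)" by blast
    define w' where "w' = w(m := (\<lambda>p. K u p / sqrt (K u u)))"
    have "K p q = (\<Sum>k<Suc m. w' k p * w' k q)" for p q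
    proof -
      have "(\<Sum>k<m. w' k p * w' k q) = (\<Sum>k<m. w k p * w k q)"
        by (intro sum.cong) (auto simp: w'_def)
      moreover have "w' m p * w' m q = K u p * K u q / K u u"
        using pos by (simp add: w'_def)
      ultimately show ?thesis using w[of p q] by (simp add: L_def)
    qed
    then show ?thesis by blast
  qed
qed

section \<open>Operations that preserve positive semidefiniteness\<close>

lemma psd_kernel_of_gram:
  fixes w :: "nat \<Rightarrow> 'v::finite \<Rightarrow> real"
  shows "psd_kernel (\<lambda>u v. \<Sum>k<m. w k u * w k v)"
  unfolding psd_kernel_def
proof (intro conjI allI)
  fix x :: "'v \<Rightarrow> real"
  have "(\<Sum>u\<in>UNIV. \<Sum>v\<in>UNIV. (\<Sum>k<m. w k u * w k v) * x u * x v)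
      = (\<Sum>u\<in>UNIV. \<Sum>v\<in>UNIV. \<Sum>k<m. (w k u * x u) * (w k v * x v))"
    by (simp add: sum_distrib_right sum_distrib_left mult_ac)
  also have "\<dots> = (\<Sum>u\<in>UNIV. \<Sum>k<m. \<Sum>v\<in>UNIV. (w k u * x u) * (w k v * x v))"
    by (intro sum.cong refl sum.swap)
  also have "\<dots> = (\<Sum>k<m. \<Sum>u\<in>UNIV. \<Sum>v\<in>UNIV. (w k u * x u) * (w k v * x v))"
    by (rule sum.swap)
  also have "\<dots> = (\<Sum>k<m. (\<Sum>u\<in>UNIV. w k u * x u) * (\<Sum>u\<in>UNIV. w k u * x u))"
    by (simp add: sum_product)
  also have "\<dots> \<ge> 0" by (intro sum_nonneg) auto
  finally show "0 \<le> (\<Sum>u\<in>UNIV. \<Sum>v\<in>UNIV. (\<Sum>k<m. w k u * w k v) * x u * x v)" .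
qed (simp add: mult.commute)

text \<open>Composing the Gram vectors of \<open>K\<close> with \<open>f\<close> gives Gram vectors
  of the pullback, whether or not \<open>f\<close> is injective.\<close>

lemma psd_kernel_pullback:
  fixes f :: "'v::finite \<Rightarrow> 't::finite"
  assumes "psd_kernel K"
  shows "psd_kernel (\<lambda>u v. K (f u) (f v))"
proof -
  obtain m :: nat and w where "\<And>p q. K p q = (\<Sum>k<m. w k p * w k q)"
    using psd_kernel_gram[OF assms] by blast
  then show ?thesis using psd_kernel_of_gram[of "\<lambda>k u. w k (f u)" m] by simp
qed

text \<open>With \<open>L\<close> in Gram form, the quadratic form of the product at
  \<open>x\<close> is the sum over \<open>k\<close> of the form of \<open>K\<close> at the vectors
  \<open>w k u * x u\<close>.\<close>

lemma psd_kernel_schur_product: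
  fixes K L :: "'v::finite \<Rightarrow> 'v \<Rightarrow> real"
  assumes K: "psd_kernel K" and L: "psd_kernel L"
  shows "psd_kernel (\<lambda>u v. K u v * L u v)"
  unfolding psd_kernel_def
proof (intro conjI allI)
  show "K u v * L u v = K v u * L v u" for u v
    using psd_kernel_sym[OF K, of u v] psd_kernel_sym[OF L, of u v] by simp
  fix x :: "'v \<Rightarrow> real"
  obtain m :: nat and w where w: "\<And>p q. L p q = (\<Sum>k<m. w k p * w k q)"
    using psd_kernel_gram[OF L] by blast
  have "(\<Sum>u\<in>UNIV. \<Sum>v\<in>UNIV. K u v * L u v * x u * x v)
      = (\<Sum>u\<in>UNIV. \<Sum>v\<in>UNIV. \<Sum>k<m. K u v * (w k u * x u) * (w k v * x v))"
    by (simp add: w sum_distrib_right sum_distrib_left mult_ac)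
  also have "\<dots> = (\<Sum>u\<in>UNIV. \<Sum>k<m. \<Sum>v\<in>UNIV. K u v * (w k u * x u) * (w k v * x v))"
    by (intro sum.cong refl sum.swap)
  also have "\<dots> = (\<Sum>k<m. \<Sum>u\<in>UNIV. \<Sum>v\<in>UNIV. K u v * (w k u * x u) * (w k v * x v))"
    by (rule sum.swap)
  also have "\<dots> \<ge> 0"
    by (rule sum_nonneg) (use K in \<open>auto simp: psd_kernel_def\<close>)
  finally show "0 \<le> (\<Sum>u\<in>UNIV. \<Sum>v\<in>UNIV. K u v * L u v * x u * x v)" .
qed

lemma psd_kernel_sum_nonneg:
  assumes "psd_kernel K"
  shows "0 \<le> (\<Sum>u\<in>UNIV. \<Sum>v\<in>UNIV. K u v)"
  using psd_kernel_quad[OF assms, of "\<lambda>_. 1"] by simp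

lemma psd_kernel_sum:
  fixes K :: "'i \<Rightarrow> 'a::finite \<Rightarrow> 'a \<Rightarrow> real"
  assumes "\<And>i. i \<in> A \<Longrightarrow> psd_kernel (K i)"
  shows "psd_kernel (\<lambda>u v. \<Sum>i\<in>A. K i u v)"
  unfolding psd_kernel_def
proof (intro conjI allI)
  show "(\<Sum>i\<in>A. K i u v) = (\<Sum>i\<in>A. K i v u)" for u v
    by (intro sum.cong refl psd_kernel_sym assms)
  fix x :: "'a \<Rightarrow> real"
  have "(\<Sum>u\<in>UNIV. \<Sum>v\<in>UNIV. (\<Sum>i\<in>A. K i u v) * x u * x v)
      = (\<Sum>u\<in>UNIV. \<Sum>v\<in>UNIV. \<Sum>i\<in>A. K i u v * x u * x v)"
    by (simp add: sum_distrib_right)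
  also have "\<dots> = (\<Sum>u\<in>UNIV. \<Sum>i\<in>A. \<Sum>v\<in>UNIV. K i u v * x u * x v)"
    by (intro sum.cong refl sum.swap)
  also have "\<dots> = (\<Sum>i\<in>A. \<Sum>u\<in>UNIV. \<Sum>v\<in>UNIV. K i u v * x u * x v)"
    by (rule sum.swap)
  also have "\<dots> \<ge> 0"
    by (rule sum_nonneg) (use assms in \<open>auto simp: psd_kernel_def\<close>)
  finally show "0 \<le> (\<Sum>u\<in>UNIV. \<Sum>v\<in>UNIV. (\<Sum>i\<in>A. K i u v) * x u * x v)" .
qed

lemma psd_kernel_add:
  assumes "psd_kernel K" "psd_kernel L"
  shows "psd_kernel (\<lambda>u v. K u v + L u v)"
  using assms by (simp add: psd_kernel_def distrib_right sum.distrib)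

lemma psd_kernel_scale:
  assumes "psd_kernel K" "0 \<le> c"
  shows "psd_kernel (\<lambda>u v. c * K u v)"
  unfolding psd_kernel_def
proof (intro conjI allI)
  show "c * K u v = c * K v u" for u v using psd_kernel_sym[OF assms(1), of u v] by simp
  fix x :: "'a \<Rightarrow> real"
  have "(\<Sum>u\<in>UNIV. \<Sum>v\<in>UNIV. c * K u v * x u * x v) = c * (\<Sum>u\<in>UNIV. \<Sum>v\<in>UNIV. K u v * x u * x v)"
    by (simp add: sum_distrib_left mult_ac)
  then show "0 \<le> (\<Sum>u\<in>UNIV. \<Sum>v\<in>UNIV. c * K u v * x u * x v)"
    using assms by (simp add: psd_kernel_def)
qed

text \<open>Constant row sums make the all-ones vector an eigenvector, so its spectral component can be
  subtracted without losing positivity.\<close>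

lemma psd_kernel_minus_const:
  fixes K :: "'v::finite \<Rightarrow> 'v \<Rightarrow> real"
  assumes K: "psd_kernel K" and row: "\<And>u. (\<Sum>v\<in>UNIV. K u v) = r"
  shows "psd_kernel (\<lambda>u v. K u v - r / real CARD('v))"
  unfolding psd_kernel_def
proof (intro conjI allI)
  show "K u v - r / real CARD('v) = K v u - r / real CARD('v)" for u v
    using psd_kernel_sym[OF K, of u v] by simp
  fix x :: "'v \<Rightarrow> real"
  let ?n = "real CARD('v)"
  define s where "s = (\<Sum>v\<in>UNIV. x v)"
  \<comment> \<open>Subtracting the mean \<open>m\<close> from \<open>x\<close> projects out the
    all-ones direction.\<close>
  define m where "m = s / ?n"
  have col: "(\<Sum>u\<in>UNIV. K u v) = r" for v
    using row[of v] psd_kernel_sym[OF K, of v] by simp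
  have 1: "(\<Sum>u\<in>UNIV. \<Sum>v\<in>UNIV. K u v * x u) = r * s"
    by (simp add: sum_distrib_right[symmetric] row s_def sum_distrib_left)
  have 2: "(\<Sum>u\<in>UNIV. \<Sum>v\<in>UNIV. K u v * x v) = r * s"
    by (subst sum.swap) (simp add: sum_distrib_right[symmetric] col s_def sum_distrib_left)
  have "0 \<le> (\<Sum>u\<in>UNIV. \<Sum>v\<in>UNIV. K u v * (x u - m) * (x v - m))"
    using psd_kernel_quad[OF K, of "\<lambda>u. x u - m"] .
  also have "\<dots> = (\<Sum>u\<in>UNIV. \<Sum>v\<in>UNIV. K u v * x u * x v) - m * (\<Sum>u\<in>UNIV. \<Sum>v\<in>UNIV. K u v * x u)
      - m * (\<Sum>u\<in>UNIV. \<Sum>v\<in>UNIV. K u v * x v) + m * m * (\<Sum>u\<in>UNIV. \<Sum>v\<in>UNIV. K u v)"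
    unfolding sum_distrib_left sum_subtractf[symmetric] sum.distrib[symmetric]
    by (intro sum.cong refl) (simp add: algebra_simps)
  also have "\<dots> = (\<Sum>u\<in>UNIV. \<Sum>v\<in>UNIV. K u v * x u * x v) - r / ?n * (s * s)"
    unfolding 1 2 row m_def by (simp add: field_simps)
  also have "\<dots> = (\<Sum>u\<in>UNIV. \<Sum>v\<in>UNIV. (K u v - r / ?n) * x u * x v)"
  proof -
    have "r / ?n * (s * s) = (\<Sum>u\<in>UNIV. \<Sum>v\<in>UNIV. r / ?n * x u * x v)"
      unfolding s_def sum_product by (simp add: sum_distrib_left mult_ac)
    then show ?thesis by (simp add: sum_subtractf left_diff_distrib)
  qed
  finally show "0 \<le> (\<Sum>u\<in>UNIV. \<Sum>v\<in>UNIV. (K u v - r / ?n) * x u * x v)" .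
qed

text \<open>As a matrix this is \<open>W\<close> multiplied on both sides by the incidence matrix of
  \<open>g\<close>, that is, \<open>W\<close> summed over pairs of fibres.\<close>

definition push_kernel :: "('v::finite \<Rightarrow> 's) \<Rightarrow> ('v \<Rightarrow> 'v \<Rightarrow> real) \<Rightarrow> 's \<Rightarrow> 's \<Rightarrow> real" where
  "push_kernel g W s t = (\<Sum>u\<in>UNIV. \<Sum>v\<in>UNIV. if g u = s \<and> g v = t then W u v else 0)"

text \<open>A change of variables with an arbitrary weight \<open>h\<close>: constant
  \<open>h\<close> gives the entry sum, the diagonal indicator the trace, and a product weight the
  quadratic form.\<close>

lemma sum_push_kernel:
  fixes g :: "'v::finite \<Rightarrow> 's::finite"
  shows "(\<Sum>s\<in>UNIV. \<Sum>t\<in>UNIV. push_kernel g W s t * h s t)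
    = (\<Sum>u\<in>UNIV. \<Sum>v\<in>UNIV. W u v * h (g u) (g v))"
proof -
  let ?F = "\<lambda>u v s t. (if g u = s \<and> g v = t then W u v else 0) * h s t"
  have "(\<Sum>s\<in>UNIV. \<Sum>t\<in>UNIV. push_kernel g W s t * h s t)
      = (\<Sum>(s,t)\<in>UNIV. \<Sum>(u,v)\<in>UNIV. ?F u v s t)"
    unfolding push_kernel_def sum_distrib_right
    by (simp only: sum.cartesian_product[symmetric] UNIV_Times_UNIV[symmetric])
  also have "\<dots> = (\<Sum>(u,v)\<in>UNIV. \<Sum>(s,t)\<in>UNIV. ?F u v s t)"
    unfolding split_def by (rule sum.swap)
  also have "\<dots> = (\<Sum>(u,v)\<in>UNIV. W u v * h (g u) (g v))"
  proof (intro sum.cong refl, clarify)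
    fix u v
    have "(\<Sum>(s,t)\<in>UNIV. ?F u v s t) = (\<Sum>p\<in>UNIV. if p = (g u, g v) then W u v * h (g u) (g v) else 0)"
      by (intro sum.cong) (auto split: if_splits)
    then show "(\<Sum>(s,t)\<in>UNIV. ?F u v s t) = W u v * h (g u) (g v)" by simp
  qed
  finally show ?thesis by (simp add: sum.cartesian_product)
qed

lemma psd_kernel_push:
  fixes g :: "'v::finite \<Rightarrow> 's::finite"
  assumes "psd_kernel W"
  shows "psd_kernel (push_kernel g W)"
  unfolding psd_kernel_def
proof (intro conjI allI)
  show "push_kernel g W s t = push_kernel g W t s" for s t
    unfolding push_kernel_def by (subst sum.swap) (auto intro!: sum.cong psd_kernel_sym[OF assms])
  show "0 \<le> (\<Sum>s\<in>UNIV. \<Sum>t\<in>UNIV. push_kernel g W s t * x s * x t)" for x :: "'s \<Rightarrow> real"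
    using sum_push_kernel[of g W "\<lambda>s t. x s * x t"] assms
    by (simp add: mult.assoc psd_kernel_def)
qed

subsection \<open>Feasible kernels for the theta functions\<close>

lemma psd_iff_psd_kernel: "psd M \<longleftrightarrow> psd_kernel (\<lambda>u v. M $ u $ v)"
proof -
  have "x \<bullet> (M *v x) = (\<Sum>u\<in>UNIV. \<Sum>v\<in>UNIV. M $ u $ v * x $ u * x $ v)" for x
    by (simp add: inner_vec_def matrix_vector_mult_def sum_distrib_left mult_ac)
  moreover have "(\<forall>x::real^'a. 0 \<le> (\<Sum>u\<in>UNIV. \<Sum>v\<in>UNIV. M $ u $ v * x $ u * x $ v))
      \<longleftrightarrow> (\<forall>x. 0 \<le> (\<Sum>u\<in>UNIV. \<Sum>v\<in>UNIV. M $ u $ v * x u * x v))" (is "?L \<longleftrightarrow> ?R")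
  proof
    assume L: ?L
    show ?R
    proof
      fix x :: "'a \<Rightarrow> real"
      show "0 \<le> (\<Sum>u\<in>UNIV. \<Sum>v\<in>UNIV. M $ u $ v * x u * x v)"
        using L[rule_format, of "\<chi> u. x u"] by simp
    qed
  qed blast
  moreover have "transpose M = M \<longleftrightarrow> (\<forall>u v. M $ u $ v = M $ v $ u)"
    by (auto simp: transpose_def vec_eq_iff)
  ultimately show ?thesis
    unfolding psd_def psd_kernel_def by (simp only:)
qed

text \<open>Feasibility for \<open>theta_L\<close>. The entrywise sign condition of
  \<open>theta_S\<close> is kept separate, so that averaging and transfer serve both
  functions.\<close>

definition theta_kernel :: "('v::finite \<Rightarrow> 'v \<Rightarrow> bool) \<Rightarrow> ('v \<Rightarrow> 'v \<Rightarrow> real) \<Rightarrow> bool" where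
  "theta_kernel G K \<longleftrightarrow> psd_kernel K \<and> (\<Sum>u\<in>UNIV. K u u) = 1 \<and> (\<forall>u v. G u v \<longrightarrow> K u v = 0)"

lemma trace_all_ones: "trace (all_ones ** M) = (\<Sum>u\<in>UNIV. \<Sum>v\<in>UNIV. M $ u $ v)"
  unfolding trace_def matrix_matrix_mult_def all_ones_def by (simp, rule sum.swap)

lemma theta_L_feasible_iff: "M \<in> theta_L_feasible G \<longleftrightarrow> theta_kernel G (\<lambda>u v. M $ u $ v)"
  by (auto simp: theta_L_feasible_def theta_kernel_def psd_iff_psd_kernel trace_def)

lemma theta_S_feasible_iff:
  "M \<in> theta_S_feasible G \<longleftrightarrow> theta_kernel G (\<lambda>u v. M $ u $ v) \<and> (\<forall>u v. 0 \<le> M $ u $ v)"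
  by (auto simp: theta_S_feasible_def theta_kernel_def psd_iff_psd_kernel trace_def)

lemma theta_L_kernel:
  assumes "irreflp G"
  obtains K where "theta_kernel G K" "theta_L G = (\<Sum>u\<in>UNIV. \<Sum>v\<in>UNIV. K u v)"
  using theta_L_attained[OF assms] by (auto simp: theta_L_feasible_iff trace_all_ones)

lemma theta_S_kernel:
  assumes "irreflp G"
  obtains K where "theta_kernel G K" "\<And>u v. 0 \<le> K u v"
    "theta_S G = (\<Sum>u\<in>UNIV. \<Sum>v\<in>UNIV. K u v)"
  using theta_S_attained[OF assms] by (auto simp: theta_S_feasible_iff trace_all_ones)

lemma theta_L_ge:
  assumes "irreflp G" "theta_kernel G K"
  shows "(\<Sum>u\<in>UNIV. \<Sum>v\<in>UNIV. K u v) \<le> theta_L G"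
proof -
  have "(\<chi> u v. K u v) \<in> theta_L_feasible G" using assms(2) by (simp add: theta_L_feasible_iff)
  then show ?thesis using theta_L_attained[OF assms(1)] trace_all_ones[of "\<chi> u v. K u v"] by auto
qed

lemma theta_S_ge:
  assumes "irreflp G" "theta_kernel G K" "\<And>u v. 0 \<le> K u v"
  shows "(\<Sum>u\<in>UNIV. \<Sum>v\<in>UNIV. K u v) \<le> theta_S G"
proof -
  have "(\<chi> u v. K u v) \<in> theta_S_feasible G" using assms(2,3) by (simp add: theta_S_feasible_iff)
  then show ?thesis using theta_S_attained[OF assms(1)] trace_all_ones[of "\<chi> u v. K u v"] by auto
qed

lemma psd_kernel_diagonal:
  assumes "0 \<le> c"
  shows "psd_kernel (\<lambda>u v. if u = v then c else 0)"
  unfolding psd_kernel_def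
proof (intro conjI allI)
  fix x :: "'a \<Rightarrow> real"
  have "(if u = v then c else 0) * x u * x v = (if v = u then c * (x u)\<^sup>2 else 0)" for u v
    by (simp add: power2_eq_square)
  then have "(\<Sum>u\<in>UNIV. \<Sum>v\<in>UNIV. (if u = v then c else 0) * x u * x v) = (\<Sum>u\<in>UNIV. c * (x u)\<^sup>2)"
    by simp
  then show "0 \<le> (\<Sum>u\<in>UNIV. \<Sum>v\<in>UNIV. (if u = v then c else 0) * x u * x v)"
    using assms by (simp add: sum_nonneg)
qed auto

text \<open>The normalised identity has entry sum 1, so both theta functions are at least 1 and may
  be divided by.\<close>

lemma theta_kernel_diagonal:
  fixes G :: "'v::finite \<Rightarrow> 'v \<Rightarrow> bool"
  assumes "irreflp G"
  shows "theta_kernel G (\<lambda>u v. if u = v then 1 / real CARD('v) else 0)"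
  using assms psd_kernel_diagonal[of "1 / real CARD('v)"]
  by (auto simp: theta_kernel_def irreflp_def)

lemma theta_L_ge_1:
  assumes "irreflp G"
  shows "1 \<le> theta_L G"
  using theta_L_ge[OF assms theta_kernel_diagonal[OF assms]] by simp

lemma theta_S_ge_1:
  assumes "irreflp G"
  shows "1 \<le> theta_S G"
  using theta_S_ge[OF assms theta_kernel_diagonal[OF assms]] by simp

subsection \<open>Vertex-transitive graphs\<close>

lemma automorphism_id: "automorphism G id"
  by (simp add: automorphism_def)

lemma automorphism_comp: "automorphism G f \<Longrightarrow> automorphism G g \<Longrightarrow> automorphism G (f \<circ> g)"
  by (auto simp: automorphism_def bij_comp)

lemma automorphism_inv:
  assumes "automorphism G f"
  shows "automorphism G (inv f)"
proof -
  have "bij f" using assms by (simp add: automorphism_def)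
  then have "f (inv f u) = u" for u by (simp add: bij_is_surj surj_f_inv_f)
  then have "G (inv f u) (inv f v) \<longleftrightarrow> G u v" for u v
    using assms[unfolded automorphism_def, THEN conjunct2, rule_format, of "inv f u" "inv f v"]
    by simp
  then show ?thesis using \<open>bij f\<close> by (simp add: automorphism_def bij_imp_bij_inv)
qed

text \<open>Used to reindex a sum over the automorphism group, which makes the average
  invariant.\<close>

lemma bij_betw_automorphism_comp:
  assumes "automorphism G g"
  shows "bij_betw (\<lambda>f. f \<circ> g) {f. automorphism G f} {f. automorphism G f}"
proof (rule bij_betwI[where g = "\<lambda>f. f \<circ> inv g"])
  have "bij g" using assms by (simp add: automorphism_def)
  then show "(f \<circ> g) \<circ> inv g = f" "(f \<circ> inv g) \<circ> g = f" for f :: "'a \<Rightarrow> 'a"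
    by (auto simp: fun_eq_iff bij_is_surj surj_f_inv_f bij_is_inj inv_f_f)
qed (auto intro: automorphism_comp automorphism_inv assms)

lemma vertex_transitiveE:
  assumes "vertex_transitive G"
  obtains f where "automorphism G f" "f u = v"
  using assms by (auto simp: vertex_transitive_def)

lemma automorphism_complement: "automorphism G f \<Longrightarrow> automorphism (complement G) f"
  by (auto simp: automorphism_def complement_def bij_def inj_eq)

lemma vertex_transitive_complement: "vertex_transitive G \<Longrightarrow> vertex_transitive (complement G)"
  unfolding vertex_transitive_def by (meson automorphism_complement)

text \<open>The group average is invariant under automorphisms, so transitivity makes its diagonal
  and row sums constant. Averaging keeps the trace and the entry sum, which fix the two
  constants.\<close>

lemma theta_kernel_average:
  fixes T :: "'t::finite \<Rightarrow> 't \<Rightarrow> bool"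
  assumes vt: "vertex_transitive T" and N: "theta_kernel T N"
  obtains A where "theta_kernel T A" "\<And>t. A t t = 1 / real CARD('t)"
    "\<And>t. (\<Sum>u\<in>UNIV. A t u) = (\<Sum>u\<in>UNIV. \<Sum>v\<in>UNIV. N u v) / real CARD('t)"
    "(\<forall>u v. 0 \<le> N u v) \<longrightarrow> (\<forall>u v. 0 \<le> A u v)"
proof -
  define \<Gamma> where "\<Gamma> = {f. automorphism T f}"
  define c where "c = 1 / real (card \<Gamma>)"
  define A where "A u v = c * (\<Sum>f\<in>\<Gamma>. N (f u) (f v))" for u v
  have "card \<Gamma> \<noteq> 0" using automorphism_id[of T] by (auto simp: \<Gamma>_def)
  then have c: "c * real (card \<Gamma>) = 1" "0 \<le> c" by (simp_all add: c_def)
  have reindex: "(\<Sum>u\<in>UNIV. F (f u)) = (\<Sum>u\<in>UNIV. F u)" if "f \<in> \<Gamma>" for f and F :: "'t \<Rightarrow> real"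
    using that sum.reindex_bij_betw[of f UNIV UNIV F] by (simp add: \<Gamma>_def automorphism_def)
  have inv: "A (g u) (g v) = A u v" if "g \<in> \<Gamma>" for g u v
  proof -
    have "(\<Sum>f\<in>\<Gamma>. N ((f \<circ> g) u) ((f \<circ> g) v)) = (\<Sum>f\<in>\<Gamma>. N (f u) (f v))"
      using that sum.reindex_bij_betw[OF bij_betw_automorphism_comp[of T g], of "\<lambda>f. N (f u) (f v)"]
      by (simp add: \<Gamma>_def)
    then show ?thesis by (simp add: A_def)
  qed
  have psd: "psd_kernel A"
  proof -
    have "psd_kernel (\<lambda>u v. N (f u) (f v))" for f
      using N by (intro psd_kernel_pullback[of N f]) (simp add: theta_kernel_def)
    then have "psd_kernel (\<lambda>u v. \<Sum>f\<in>\<Gamma>. N (f u) (f v))"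
      by (rule psd_kernel_sum)
    from psd_kernel_scale[OF this c(2)] show ?thesis unfolding A_def .
  qed
  have tr: "(\<Sum>u\<in>UNIV. A u u) = 1"
  proof -
    have "(\<Sum>u\<in>UNIV. A u u) = c * (\<Sum>f\<in>\<Gamma>. \<Sum>u\<in>UNIV. N (f u) (f u))"
      unfolding A_def sum_distrib_left[symmetric] by (subst sum.swap) simp
    also have "\<dots> = c * (\<Sum>f\<in>\<Gamma>. 1)"
      using N reindex[of _ "\<lambda>u. N u u"] by (simp add: theta_kernel_def)
    finally show ?thesis using c by simp
  qed
  have sum: "(\<Sum>u\<in>UNIV. \<Sum>v\<in>UNIV. A u v) = (\<Sum>u\<in>UNIV. \<Sum>v\<in>UNIV. N u v)" (is "_ = ?s")
  proof -
    have "(\<Sum>u\<in>UNIV. \<Sum>v\<in>UNIV. A u v) = c * (\<Sum>u\<in>UNIV. \<Sum>v\<in>UNIV. \<Sum>f\<in>\<Gamma>. N (f u) (f v))"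
      unfolding A_def by (simp add: sum_distrib_left)
    also have "(\<Sum>u\<in>UNIV. \<Sum>v\<in>UNIV. \<Sum>f\<in>\<Gamma>. N (f u) (f v)) = (\<Sum>u\<in>UNIV. \<Sum>f\<in>\<Gamma>. \<Sum>v\<in>UNIV. N (f u) (f v))"
      by (intro sum.cong refl sum.swap)
    also have "\<dots> = (\<Sum>f\<in>\<Gamma>. \<Sum>u\<in>UNIV. \<Sum>v\<in>UNIV. N (f u) (f v))"
      by (rule sum.swap)
    also have "\<dots> = (\<Sum>f\<in>\<Gamma>. ?s)"
    proof (rule sum.cong[OF refl])
      fix f assume f: "f \<in> \<Gamma>"
      show "(\<Sum>u\<in>UNIV. \<Sum>v\<in>UNIV. N (f u) (f v)) = ?s"
        using reindex[OF f, of "\<lambda>u. \<Sum>v\<in>UNIV. N u v"] by (simp only: reindex[OF f])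
    qed
    finally show ?thesis using c by simp
  qed
  have diag: "A t t = 1 / real CARD('t)" for t
  proof -
    have "A u u = A t t" for u
      using vertex_transitiveE[OF vt, of t u] inv[of _ t t] by (metis \<Gamma>_def mem_Collect_eq)
    then have "(\<Sum>u\<in>UNIV. A u u) = (\<Sum>u\<in>(UNIV::'t set). A t t)" by (rule sum.cong[OF refl])
    then show ?thesis using tr by (simp add: field_simps)
  qed
  have row: "(\<Sum>u\<in>UNIV. A t u) = ?s / real CARD('t)" for t
  proof -
    have "(\<Sum>v\<in>UNIV. A u v) = (\<Sum>v\<in>UNIV. A t v)" for u
    proof -
      obtain f where f: "f \<in> \<Gamma>" "f t = u"
        using vertex_transitiveE[OF vt, of t u] by (metis \<Gamma>_def mem_Collect_eq)
      then show ?thesis using reindex[OF f(1), of "A u"] inv[OF f(1), of t] by simp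
    qed
    then have "(\<Sum>u\<in>UNIV. \<Sum>v\<in>UNIV. A u v) = (\<Sum>u\<in>(UNIV::'t set). \<Sum>v\<in>UNIV. A t v)"
      by (rule sum.cong[OF refl])
    then show ?thesis using sum by (simp add: field_simps)
  qed
  have zero: "A u v = 0" if "T u v" for u v
    using that N unfolding A_def theta_kernel_def \<Gamma>_def automorphism_def by simp
  show ?thesis
  proof (rule that[of A])
    show "theta_kernel T A" using psd tr zero by (simp add: theta_kernel_def)
    show "(\<forall>u v. 0 \<le> N u v) \<longrightarrow> (\<forall>u v. 0 \<le> A u v)"
      using c by (simp add: A_def sum_nonneg)
  qed (fact diag row)+
qed

text \<open>The common construction behind all theta inequalities; the last conclusion carries the
  sign condition for \<open>theta_S\<close>.\<close>

lemma theta_kernel_transfer: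
  fixes T :: "'t::finite \<Rightarrow> 't \<Rightarrow> bool" and H :: "'v::finite \<Rightarrow> 'v \<Rightarrow> bool"
    and K :: "'s::finite \<Rightarrow> 's \<Rightarrow> bool"
  assumes vt: "vertex_transitive T"
    and edge: "\<And>u v. K (g u) (g v) \<Longrightarrow> T (f u) (f v) \<or> H u v"
    and fibre: "\<And>u v. u \<noteq> v \<Longrightarrow> g u = g v \<Longrightarrow> T (f u) (f v) \<or> H u v"
    and N: "theta_kernel T N" and M: "theta_kernel H M"
  obtains Z where "theta_kernel K Z"
    "(\<Sum>u\<in>UNIV. \<Sum>v\<in>UNIV. N u v) * (\<Sum>u\<in>UNIV. \<Sum>v\<in>UNIV. M u v)
       \<le> real CARD('t) * (\<Sum>u\<in>UNIV. \<Sum>v\<in>UNIV. Z u v)"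
    "(\<forall>u v. 0 \<le> N u v) \<longrightarrow> (\<forall>u v. 0 \<le> M u v) \<longrightarrow> (\<forall>u v. 0 \<le> Z u v)"
proof -
  let ?n = "real CARD('t)"
  let ?s = "\<Sum>u\<in>UNIV. \<Sum>v\<in>UNIV. N u v"
  obtain A where A: "theta_kernel T A" and diag: "\<And>t. A t t = 1 / ?n"
    and row: "\<And>t. (\<Sum>u\<in>UNIV. A t u) = ?s / ?n"
    and nonneg: "(\<forall>u v. 0 \<le> N u v) \<longrightarrow> (\<forall>u v. 0 \<le> A u v)"
    by (rule theta_kernel_average[OF vt N]) blast
  have psdM: "psd_kernel M" and psdA: "psd_kernel A"
    using M A by (simp_all add: theta_kernel_def)
  define W where "W u v = A (f u) (f v) * M u v" for u v
  have W: "psd_kernel W"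
    unfolding W_def by (rule psd_kernel_schur_product[OF psd_kernel_pullback[OF psdA, of f] psdM])
  have W0: "W u v = 0" if "T (f u) (f v) \<or> H u v" for u v
    using that M A by (auto simp: W_def theta_kernel_def)
  \<comment> \<open>The factor \<open>?n\<close> compensates for the diagonal \<open>1 / ?n\<close>
    of \<open>A\<close>, so that \<open>Z\<close> has trace 1.\<close>
  define Z where "Z s t = ?n * push_kernel g W s t" for s t
  have sumZ: "(\<Sum>s\<in>UNIV. \<Sum>t\<in>UNIV. Z s t) = ?n * (\<Sum>u\<in>UNIV. \<Sum>v\<in>UNIV. W u v)"
    using sum_push_kernel[of g W "\<lambda>_ _. 1"] by (simp add: Z_def sum_distrib_left[symmetric])
  have "(\<Sum>s\<in>UNIV. push_kernel g W s s)
      = (\<Sum>s\<in>UNIV. \<Sum>t\<in>UNIV. push_kernel g W s t * (if s = t then 1 else 0))"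
    by (simp add: if_distrib[of "\<lambda>c. _ * c"] cong: if_cong)
  also have "\<dots> = (\<Sum>u\<in>UNIV. \<Sum>v\<in>UNIV. W u v * (if g u = g v then 1 else 0))"
    by (rule sum_push_kernel)
  \<comment> \<open>Distinct vertices in one fibre of \<open>g\<close> contribute nothing, by
    \<open>fibre\<close> and \<open>W0\<close>.\<close>
  also have "\<dots> = (\<Sum>u\<in>UNIV. \<Sum>v\<in>UNIV. if v = u then W u u else 0)"
    by (intro sum.cong refl) (auto simp: W0[OF fibre])
  also have "\<dots> = (\<Sum>u\<in>UNIV. M u u) / ?n"
    by (simp add: W_def diag sum_divide_distrib)
  also have "\<dots> = 1 / ?n" using M by (simp add: theta_kernel_def)
  finally have trZ: "(\<Sum>s\<in>UNIV. Z s s) = 1"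
    by (simp add: Z_def sum_distrib_left[symmetric])
  have Z0: "Z s t = 0" if "K s t" for s t
    unfolding Z_def push_kernel_def using that by (auto intro!: sum.neutral W0 edge)
  have psdZ: "psd_kernel Z"
    unfolding Z_def by (rule psd_kernel_scale[OF psd_kernel_push[OF W]]) simp
  \<comment> \<open>Removing the all-ones component of \<open>A\<close> before the Schur product
    keeps it psd; its nonnegative entry sum is the desired lower bound for \<open>W\<close>.\<close>
  have "0 \<le> (\<Sum>u\<in>UNIV. \<Sum>v\<in>UNIV. (A (f u) (f v) - ?s / ?n / ?n) * M u v)"
    by (rule psd_kernel_sum_nonneg[OF psd_kernel_schur_product[OF
          psd_kernel_pullback[OF psd_kernel_minus_const[OF psdA row], of f] psdM]])
  also have "\<dots> = (\<Sum>u\<in>UNIV. \<Sum>v\<in>UNIV. W u v) - ?s / ?n / ?n * (\<Sum>u\<in>UNIV. \<Sum>v\<in>UNIV. M u v)"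
    by (simp only: W_def left_diff_distrib sum_subtractf sum_distrib_left)
  finally have "?s * (\<Sum>u\<in>UNIV. \<Sum>v\<in>UNIV. M u v) \<le> ?n * (?n * (\<Sum>u\<in>UNIV. \<Sum>v\<in>UNIV. W u v))"
    by (simp add: field_simps)
  then have le: "?s * (\<Sum>u\<in>UNIV. \<Sum>v\<in>UNIV. M u v) \<le> ?n * (\<Sum>s\<in>UNIV. \<Sum>t\<in>UNIV. Z s t)"
    by (simp only: sumZ)
  show ?thesis
  proof (rule that[OF _ le])
    show "theta_kernel K Z" using psdZ trZ Z0 by (simp add: theta_kernel_def)
    show "(\<forall>u v. 0 \<le> N u v) \<longrightarrow> (\<forall>u v. 0 \<le> M u v) \<longrightarrow> (\<forall>u v. 0 \<le> Z u v)"
      using nonneg by (auto simp: Z_def push_kernel_def W_def intro!: sum_nonneg mult_nonneg_nonneg)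
  qed
qed

subsection \<open>Duality for the Lovasz theta function\<close>

lemma inner_matrix: "A \<bullet> B = (\<Sum>u\<in>UNIV. \<Sum>v\<in>UNIV. A $ u $ v * B $ u $ v)"
  for A B :: "real^'n^'m"
  by (simp add: inner_vec_def)

lemma psd_scale: "psd M \<Longrightarrow> 0 \<le> c \<Longrightarrow> psd (c *\<^sub>R M)"
  using psd_kernel_scale[of "\<lambda>u v. M $ u $ v" c] by (simp add: psd_iff_psd_kernel)

lemma psd_add:
  assumes "psd M" "psd N"
  shows "psd (M + N)"
  using assms psd_kernel_add[of "\<lambda>u v. M $ u $ v" "\<lambda>u v. N $ u $ v"]
  by (simp add: psd_iff_psd_kernel)

text \<open>A dual certificate by separation. \<open>0 \<in> C\<close> says that
  \<open>D + A\<close> is psd for some \<open>A\<close> in \<open>L\<close>. Otherwise a separating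
  \<open>W\<close> is orthogonal to \<open>L\<close> and nonpositive on psd matrices, so
  \<open>- W\<close>, scaled to trace 1, is feasible with value at least \<open>t\<close>,
  contradicting \<open>theta_L G < t\<close>.\<close>

lemma theta_L_dual:
  fixes G :: "'v::finite \<Rightarrow> 'v \<Rightarrow> bool"
  assumes G: "simple_graph G" and t: "theta_L G < t"
  obtains P where "psd_kernel P" "\<And>u. P u u = t - 1"
    "\<And>u v. u \<noteq> v \<Longrightarrow> \<not> G u v \<Longrightarrow> P u v = -1"
proof -
  have irr: "irreflp G" and sym: "G u v \<Longrightarrow> G v u" for u v
    using G by (auto simp: simple_graph_def symp_def)
  define D :: "real^'v^'v" where "D = (\<chi> u v. (if u = v then t else 0) - 1)"
  \<comment> \<open>\<open>L\<close> contains the antisymmetric matrices, which forces the separating matrix to be symmetric.\<close>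
  define L :: "(real^'v^'v) set" where "L = {A. \<forall>u v. G u v \<or> A $ u $ v + A $ v $ u = 0}"
  define C where "C = {D + A - P |A P. A \<in> L \<and> psd P}"
  have psd0: "psd (0 :: real^'v^'v)" by (simp add: psd_iff_psd_kernel psd_kernel_def)
  have "0 \<in> C"
  proof (rule ccontr)
    assume "0 \<notin> C"
    moreover have "convex C"
    proof (rule convexI)
      fix M N and a b :: real
      assume MN: "M \<in> C" "N \<in> C" and ab: "0 \<le> a" "0 \<le> b" "a + b = 1"
      obtain A P where M: "M = D + A - P" "A \<in> L" "psd P" using MN by (auto simp: C_def)
      obtain B Q where N: "N = D + B - Q" "B \<in> L" "psd Q" using MN by (auto simp: C_def)
      have "a *\<^sub>R M + b *\<^sub>R N = (a + b) *\<^sub>R D + (a *\<^sub>R A + b *\<^sub>R B) - (a *\<^sub>R P + b *\<^sub>R Q)"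
        by (simp add: M N algebra_simps)
      then have eq: "a *\<^sub>R M + b *\<^sub>R N = D + (a *\<^sub>R A + b *\<^sub>R B) - (a *\<^sub>R P + b *\<^sub>R Q)"
        using ab by simp
      have "a *\<^sub>R A + b *\<^sub>R B \<in> L"
        unfolding L_def mem_Collect_eq
      proof (intro allI)
        fix u v
        have "a * (A $ u $ v + A $ v $ u) + b * (B $ u $ v + B $ v $ u) = 0" if "\<not> G u v"
        proof -
          have "A $ u $ v + A $ v $ u = 0" "B $ u $ v + B $ v $ u = 0"
            using that M(2) N(2) by (auto simp: L_def)
          then show ?thesis by simp
        qed
        then show "G u v \<or> (a *\<^sub>R A + b *\<^sub>R B) $ u $ v + (a *\<^sub>R A + b *\<^sub>R B) $ v $ u = 0"
          by (auto simp: algebra_simps)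
      qed
      moreover have "psd (a *\<^sub>R P + b *\<^sub>R Q)"
        using M N ab by (intro psd_add psd_scale)
      ultimately show "a *\<^sub>R M + b *\<^sub>R N \<in> C" unfolding C_def eq by blast
    qed
    ultimately obtain W where W0: "W \<noteq> 0" and W: "\<And>c. c \<in> C \<Longrightarrow> 0 \<le> W \<bullet> c"
      using separating_hyperplane_set_0[of C] by blast
    have WA: "W \<bullet> A = 0" if A: "A \<in> L" for A
    proof (rule ccontr)
      assume nz: "W \<bullet> A \<noteq> 0"
      \<comment> \<open>\<open>L\<close> is closed under scaling; this multiple of \<open>A\<close>
        would bring the inner product down to -1.\<close>
      define s where "s = - (W \<bullet> D + 1) / (W \<bullet> A)"
      have "s *\<^sub>R A \<in> L"
        using A by (auto simp: L_def distrib_left[symmetric])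
      then have "D + s *\<^sub>R A - 0 \<in> C" using psd0 unfolding C_def by blast
      from W[OF this] have "0 \<le> W \<bullet> D + s * (W \<bullet> A)" by (simp add: inner_add_right)
      then show False using nz by (simp add: s_def)
    qed
    have WP: "W \<bullet> P \<le> 0" if P: "psd P" for P
    proof (rule ccontr)
      assume nz: "\<not> W \<bullet> P \<le> 0"
      \<comment> \<open>This multiple of \<open>P\<close> pushes the inner product to at most
        -1.\<close>
      define s where "s = (\<bar>W \<bullet> D\<bar> + 1) / (W \<bullet> P)"
      have "psd (s *\<^sub>R P)" using nz P by (intro psd_scale) (auto simp: s_def)
      moreover have "0 \<in> L" by (simp add: L_def)
      ultimately have "D + 0 - s *\<^sub>R P \<in> C" unfolding C_def by blast
      from W[OF this] have "0 \<le> W \<bullet> D - s * (W \<bullet> P)" by (simp add: inner_diff_right)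
      then show False using nz by (simp add: s_def)
    qed
    \<comment> \<open>Matrix units, whose inner products with \<open>W\<close> read off its
      entries.\<close>
    define E :: "'v \<Rightarrow> 'v \<Rightarrow> real^'v^'v"
      where "E u v = (\<chi> p q. if p = u \<and> q = v then 1 else 0)" for u v
    have E: "W \<bullet> E u v = W $ u $ v" for u v
    proof -
      have eq: "W $ p $ q * E u v $ p $ q = (if q = v then if p = u then W $ u $ v else 0 else 0)"
        for p q by (simp add: E_def)
      show ?thesis unfolding inner_matrix eq by simp
    qed
    have Wsym: "W $ u $ v = W $ v $ u" for u v
    proof -
      have "E v u $ p $ q = E u v $ q $ p" for p q by (simp add: E_def conj_commute)
      then have "E u v - E v u \<in> L" by (simp add: L_def)
      from WA[OF this] show ?thesis by (simp add: inner_diff_right E)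
    qed
    have WG: "W $ u $ v = 0" if "G u v" for u v
    proof -
      have "E u v \<in> L" using that sym[OF that] by (auto simp: L_def E_def)
      from WA[OF this] show ?thesis by (simp add: E)
    qed
    define M where "M u v = - (W $ u $ v)" for u v
    have psdM: "psd_kernel M"
      unfolding psd_kernel_def
    proof (intro conjI allI)
      show "M u v = M v u" for u v by (simp add: M_def Wsym[of u v])
      fix x :: "'v \<Rightarrow> real"
      \<comment> \<open>Testing \<open>WP\<close> on rank-one matrices gives the quadratic form of
        \<open>M\<close>.\<close>
      have "psd_kernel (\<lambda>u v. \<Sum>k<1::nat. x u * x v)"
        by (rule psd_kernel_of_gram[where w = "\<lambda>_. x"])
      then have "psd (\<chi> u v. x u * x v)" by (simp add: psd_iff_psd_kernel)
      from WP[OF this] show "0 \<le> (\<Sum>u\<in>UNIV. \<Sum>v\<in>UNIV. M u v * x u * x v)"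
        by (simp add: inner_matrix M_def sum_negf mult.assoc)
    qed
    define \<tau> where "\<tau> = (\<Sum>u\<in>UNIV. M u u)"
    \<comment> \<open>A psd kernel of trace zero vanishes, whereas \<open>W\<close> is
      nonzero.\<close>
    have "\<tau> \<noteq> 0"
    proof
      assume "\<tau> = 0"
      then have "M u u = 0" for u
        unfolding \<tau>_def using psd_kernel_diag_nonneg[OF psdM] by (simp add: sum_nonneg_eq_0_iff)
      then have "M u v = 0" for u v using psd_kernel_zero_row[OF psdM] by blast
      then have "W = 0" by (simp add: M_def vec_eq_iff)
      with W0 show False by simp
    qed
    moreover have "0 \<le> \<tau>" unfolding \<tau>_def by (intro sum_nonneg psd_kernel_diag_nonneg[OF psdM])
    ultimately have \<tau>: "0 < \<tau>" by simp
    have "psd_kernel (\<lambda>u v. 1 / \<tau> * M u v)" using psdM \<tau> by (intro psd_kernel_scale) auto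
    moreover have "(\<Sum>u\<in>UNIV. 1 / \<tau> * M u u) = 1"
      using \<tau> by (simp only: sum_distrib_left[symmetric] \<tau>_def[symmetric]) simp
    ultimately have "theta_kernel G (\<lambda>u v. 1 / \<tau> * M u v)"
      using WG by (simp add: theta_kernel_def M_def)
    from theta_L_ge[OF irr this] have le: "(\<Sum>u\<in>UNIV. \<Sum>v\<in>UNIV. M u v) \<le> theta_L G * \<tau>"
      using \<tau> by (simp add: field_simps flip: sum_divide_distrib)
    have "0 \<in> L" by (simp add: L_def)
    \<comment> \<open>The point \<open>D\<close> of \<open>C\<close> itself bounds the entry sum of
      \<open>M\<close> below by \<open>t * \<tau>\<close>.\<close>
    then have "D + 0 - 0 \<in> C" using psd0 unfolding C_def by blast
    from W[OF this] have "0 \<le> (\<Sum>u\<in>UNIV. \<Sum>v\<in>UNIV. W $ u $ v * D $ u $ v)"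
      by (simp add: inner_matrix)
    also have "\<dots> = (\<Sum>u\<in>UNIV. \<Sum>v\<in>UNIV. M u v - (if v = u then t * M u u else 0))"
      by (intro sum.cong refl) (auto simp: D_def M_def algebra_simps)
    also have "\<dots> = (\<Sum>u\<in>UNIV. \<Sum>v\<in>UNIV. M u v) - t * \<tau>"
      by (simp add: sum_subtractf \<tau>_def sum_distrib_left)
    finally have "t * \<tau> \<le> theta_L G * \<tau>" using le by simp
    then show False using t \<tau> by simp
  qed
  then obtain A P where AP: "A \<in> L" "psd P" "P = D + A" by (auto simp: C_def)
  have psdP: "psd_kernel (\<lambda>u v. P $ u $ v)" using AP by (simp add: psd_iff_psd_kernel)
  \<comment> \<open>\<open>P\<close> and \<open>D\<close> are symmetric, hence so is
    \<open>A\<close>; the condition in \<open>L\<close> then makes twice each non-edge entry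
    zero.\<close>
  have "A $ u $ v = A $ v $ u" for u v
    using psd_kernel_sym[OF psdP, of u v] by (simp add: AP D_def split: if_splits)
  then have A0: "A $ u $ v = 0" if "\<not> G u v" for u v
    using that AP(1) by (fastforce simp: L_def)
  show ?thesis
  proof (rule that[OF psdP])
    show "P $ u $ u = t - 1" for u
      using irr A0[of u u] by (simp add: AP D_def irreflp_def)
    show "P $ u $ v = -1" if "u \<noteq> v" "\<not> G u v" for u v
      using that A0[of u v] by (simp add: AP D_def)
  qed
qed

lemma irreflp_complement: "irreflp (complement G)"
  by (simp add: complement_def irreflp_def)

text \<open>Adding the all-ones kernel to the certificate \<open>P\<close> cancels its -1 entries,
  giving a feasible kernel for the complement after scaling. As \<open>P\<close> has nonnegative
  entry sum, the value is at least \<open>?n / t\<close>; then \<open>t\<close> tends to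
  \<open>theta_L G\<close>.\<close>

lemma card_le_theta_L_mult_theta_L_complement:
  fixes G :: "'v::finite \<Rightarrow> 'v \<Rightarrow> bool"
  assumes G: "simple_graph G"
  shows "real CARD('v) \<le> theta_L G * theta_L (complement G)"
proof -
  let ?n = "real CARD('v)"
  have irr: "irreflp G" using G by (simp add: simple_graph_def)
  have "?n \<le> t * theta_L (complement G)" if t: "theta_L G < t" for t
  proof -
    have t0: "0 < t" using t theta_L_ge_1[OF irr] by linarith
    obtain P where P: "psd_kernel P" "\<And>u. P u u = t - 1"
      "\<And>u v. u \<noteq> v \<Longrightarrow> \<not> G u v \<Longrightarrow> P u v = -1"
      using theta_L_dual[OF G t] by metis
    \<comment> \<open>\<open>P u u + 1 = t\<close> at all \<open>?n\<close> vertices, so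
      \<open>c\<close> normalises the trace to 1.\<close>
    define c where "c = 1 / (t * ?n)"
    define K where "K u v = c * (P u v + 1)" for u v
    have "psd_kernel (\<lambda>u v. P u v + 1)"
      using psd_kernel_add[OF P(1) psd_kernel_of_gram[of "\<lambda>_ _. 1" 1]] by simp
    then have "psd_kernel K"
      unfolding K_def using t0 by (intro psd_kernel_scale) (auto simp: c_def)
    then have "theta_kernel (complement G) K"
      using t0 P(2,3) by (simp add: theta_kernel_def K_def complement_def c_def)
    from theta_L_ge[OF irreflp_complement this]
    have "(\<Sum>u\<in>UNIV. \<Sum>v\<in>UNIV. K u v) \<le> theta_L (complement G)" .
    moreover have "(\<Sum>u\<in>UNIV. \<Sum>v\<in>UNIV. K u v) = c * ((\<Sum>u\<in>UNIV. \<Sum>v\<in>UNIV. P u v) + ?n * ?n)"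
      by (simp add: K_def sum_distrib_left[symmetric] sum.distrib)
    moreover have "c * (?n * ?n) \<le> c * ((\<Sum>u\<in>UNIV. \<Sum>v\<in>UNIV. P u v) + ?n * ?n)"
      using psd_kernel_sum_nonneg[OF P(1)] t0 by (intro mult_left_mono) (auto simp: c_def)
    ultimately have "c * (?n * ?n) \<le> theta_L (complement G)" by linarith
    then show ?thesis using t0 by (simp add: c_def field_simps)
  qed
  then have "?n / theta_L (complement G) \<le> t" if "theta_L G < t" for t
    using that theta_L_ge_1[OF irreflp_complement, of G] by (simp add: field_simps)
  then have "?n / theta_L (complement G) \<le> theta_L G" by (rule dense_ge)
  then show ?thesis using theta_L_ge_1[OF irreflp_complement, of G] by (simp add: field_simps)
qed

subsection \<open>Products of theta functions\<close>

lemma theta_L_mult_le: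
  fixes T :: "'t::finite \<Rightarrow> 't \<Rightarrow> bool" and H :: "'v::finite \<Rightarrow> 'v \<Rightarrow> bool"
    and K :: "'s::finite \<Rightarrow> 's \<Rightarrow> bool"
  assumes "vertex_transitive T" "irreflp T" "irreflp H" "irreflp K"
    and "\<And>u v. K (g u) (g v) \<Longrightarrow> T (f u) (f v) \<or> H u v"
    and "\<And>u v. u \<noteq> v \<Longrightarrow> g u = g v \<Longrightarrow> T (f u) (f v) \<or> H u v"
  shows "theta_L T * theta_L H \<le> real CARD('t) * theta_L K"
proof -
  obtain N where N: "theta_kernel T N" "theta_L T = (\<Sum>u\<in>UNIV. \<Sum>v\<in>UNIV. N u v)"
    by (rule theta_L_kernel[OF assms(2)])
  obtain M where M: "theta_kernel H M" "theta_L H = (\<Sum>u\<in>UNIV. \<Sum>v\<in>UNIV. M u v)"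
    by (rule theta_L_kernel[OF assms(3)])
  obtain Z where Z: "theta_kernel K Z"
    "(\<Sum>u\<in>UNIV. \<Sum>v\<in>UNIV. N u v) * (\<Sum>u\<in>UNIV. \<Sum>v\<in>UNIV. M u v)
       \<le> real CARD('t) * (\<Sum>u\<in>UNIV. \<Sum>v\<in>UNIV. Z u v)"
    by (rule theta_kernel_transfer[of T K g f H, OF assms(1,5,6) N(1) M(1)])
  have "real CARD('t) * (\<Sum>u\<in>UNIV. \<Sum>v\<in>UNIV. Z u v) \<le> real CARD('t) * theta_L K"
    using theta_L_ge[OF assms(4) Z(1)] by (intro mult_left_mono) auto
  with Z(2) show ?thesis unfolding N(2) M(2) by linarith
qed

lemma theta_S_mult_le:
  fixes T :: "'t::finite \<Rightarrow> 't \<Rightarrow> bool" and H :: "'v::finite \<Rightarrow> 'v \<Rightarrow> bool"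
    and K :: "'s::finite \<Rightarrow> 's \<Rightarrow> bool"
  assumes "vertex_transitive T" "irreflp T" "irreflp H" "irreflp K"
    and "\<And>u v. K (g u) (g v) \<Longrightarrow> T (f u) (f v) \<or> H u v"
    and "\<And>u v. u \<noteq> v \<Longrightarrow> g u = g v \<Longrightarrow> T (f u) (f v) \<or> H u v"
  shows "theta_S T * theta_S H \<le> real CARD('t) * theta_S K"
proof -
  obtain N where N: "theta_kernel T N" "\<And>u v. 0 \<le> N u v" "theta_S T = (\<Sum>u\<in>UNIV. \<Sum>v\<in>UNIV. N u v)"
    by (rule theta_S_kernel[OF assms(2)]) blast
  obtain M where M: "theta_kernel H M" "\<And>u v. 0 \<le> M u v" "theta_S H = (\<Sum>u\<in>UNIV. \<Sum>v\<in>UNIV. M u v)"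
    by (rule theta_S_kernel[OF assms(3)]) blast
  obtain Z where Z: "theta_kernel K Z"
    "(\<Sum>u\<in>UNIV. \<Sum>v\<in>UNIV. N u v) * (\<Sum>u\<in>UNIV. \<Sum>v\<in>UNIV. M u v)
       \<le> real CARD('t) * (\<Sum>u\<in>UNIV. \<Sum>v\<in>UNIV. Z u v)"
    "(\<forall>u v. 0 \<le> N u v) \<longrightarrow> (\<forall>u v. 0 \<le> M u v) \<longrightarrow> (\<forall>u v. 0 \<le> Z u v)"
    by (rule theta_kernel_transfer[of T K g f H, OF assms(1,5,6) N(1) M(1)])
  have "real CARD('t) * (\<Sum>u\<in>UNIV. \<Sum>v\<in>UNIV. Z u v) \<le> real CARD('t) * theta_S K"
    using theta_S_ge[OF assms(4) Z(1)] Z(3) N(2) M(2) by (intro mult_left_mono) auto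
  with Z(2) show ?thesis unfolding N(3) M(3) by linarith
qed

lemma theta_L_unit: "theta_L (\<lambda>_ _ :: unit. False) = 1"
proof -
  obtain K :: "unit \<Rightarrow> unit \<Rightarrow> real" where "theta_kernel (\<lambda>_ _. False) K"
    "theta_L (\<lambda>_ _ :: unit. False) = (\<Sum>u\<in>UNIV. \<Sum>v\<in>UNIV. K u v)"
    by (rule theta_L_kernel[of "\<lambda>_ _ :: unit. False"]) (simp add: irreflp_def)
  then show ?thesis by (simp add: theta_kernel_def UNIV_unit)
qed

text \<open>For the upper bound, \<open>f\<close> is the identity and \<open>g\<close> collapses
  everything to a point: distinct vertices are adjacent in \<open>G\<close> or in its complement.
  The lower bound is duality.\<close>

lemma theta_L_mult_theta_L_complement:
  fixes G :: "'v::finite \<Rightarrow> 'v \<Rightarrow> bool"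
  assumes G: "simple_graph G" and vt: "vertex_transitive G"
  shows "theta_L G * theta_L (complement G) = real CARD('v)"
proof (rule antisym)
  have "irreflp G" using G by (simp add: simple_graph_def)
  then show "theta_L G * theta_L (complement G) \<le> real CARD('v)"
    using theta_L_mult_le[of G "complement G" "\<lambda>_ _ :: unit. False" "\<lambda>_. ()" "\<lambda>v. v"] vt
    by (auto simp: theta_L_unit irreflp_complement complement_def irreflp_def)
qed (rule card_le_theta_L_mult_theta_L_complement[OF G])

subsection \<open>Independence numbers\<close>

lemma independence_number_ge:
  fixes G :: "'v::finite \<Rightarrow> 'v \<Rightarrow> bool"
  assumes "independent_set G S"
  shows "card S \<le> independence_number G"
proof -
  have "finite {card S |S. independent_set G S}" by simp
  then show ?thesis unfolding independence_number_def using assms by (intro Max_ge) auto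
qed

lemma independence_number_attained:
  fixes G :: "'v::finite \<Rightarrow> 'v \<Rightarrow> bool"
  obtains S where "independent_set G S" "independence_number G = card S"
proof -
  have "independent_set G {}" by (simp add: independent_set_def)
  then have "{card S |S. independent_set G S} \<noteq> {}" by blast
  moreover have "finite {card S |S. independent_set G S}" by simp
  ultimately have "independence_number G \<in> {card S |S. independent_set G S}"
    unfolding independence_number_def by (rule Max_in[rotated])
  then show ?thesis using that by blast
qed

lemma independence_number_pos:
  fixes G :: "'v::finite \<Rightarrow> 'v \<Rightarrow> bool"
  assumes "irreflp G"
  shows "0 < independence_number G"
proof -
  have "independent_set G {undefined}" using assms by (simp add: independent_set_def irreflp_def)
  from independence_number_ge[OF this] show ?thesis by simp
qed

text \<open>Composing with an automorphism that takes \<open>s\<close> to \<open>r\<close> injects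
  one class into the other, so the classes partitioning the group by the image of \<open>t\<close>
  are equally large.\<close>

lemma card_automorphisms_maps_to:
  fixes T :: "'t::finite \<Rightarrow> 't \<Rightarrow> bool"
  assumes vt: "vertex_transitive T"
  shows "CARD('t) * card {\<phi>. automorphism T \<phi> \<and> \<phi> t = s} = card {\<phi>. automorphism T \<phi>}"
proof -
  have same: "card {\<phi>. automorphism T \<phi> \<and> \<phi> t = s} = card {\<phi>. automorphism T \<phi> \<and> \<phi> t = r}" for s r
  proof -
    have le: "card {\<phi>. automorphism T \<phi> \<and> \<phi> t = s} \<le> card {\<phi>. automorphism T \<phi> \<and> \<phi> t = r}" for s r
    proof -
      obtain \<psi> where \<psi>: "automorphism T \<psi>" "\<psi> s = r" by (rule vertex_transitiveE[OF vt])
      have "inj \<psi>" using \<psi> by (simp add: automorphism_def bij_is_inj)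
      then have "inj_on (\<lambda>\<phi>. \<psi> \<circ> \<phi>) {\<phi>. automorphism T \<phi> \<and> \<phi> t = s}"
        by (intro inj_onI ext) (metis comp_apply injD)
      moreover have "(\<lambda>\<phi>. \<psi> \<circ> \<phi>) ` {\<phi>. automorphism T \<phi> \<and> \<phi> t = s} \<subseteq> {\<phi>. automorphism T \<phi> \<and> \<phi> t = r}"
        using \<psi> by (auto intro: automorphism_comp)
      ultimately show ?thesis by (intro card_inj_on_le) auto
    qed
    show ?thesis using le[of s r] le[of r s] by simp
  qed
  have "{\<phi>. automorphism T \<phi>} = (\<Union>r. {\<phi>. automorphism T \<phi> \<and> \<phi> t = r})" by auto
  also have "card \<dots> = (\<Sum>r\<in>UNIV. card {\<phi>. automorphism T \<phi> \<and> \<phi> t = r})"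
    by (intro card_UN_disjoint) auto
  also have "\<dots> = CARD('t) * card {\<phi>. automorphism T \<phi> \<and> \<phi> t = s}"
  proof -
    have "(\<Sum>r\<in>UNIV. card {\<phi>. automorphism T \<phi> \<and> \<phi> t = r})
        = (\<Sum>r\<in>(UNIV::'t set). card {\<phi>. automorphism T \<phi> \<and> \<phi> t = s})"
      by (rule sum.cong[OF refl same])
    then show ?thesis by simp
  qed
  finally show ?thesis by simp
qed

text \<open>An average automorphic image of a maximum independent set of \<open>T\<close> meets \<open>S\<close> in
  \<open>\<alpha>(T) * |S| / |V(T)|\<close> vertices (under \<open>f\<close>), and \<open>g\<close> carries this intersection injectively to an
  independent set of \<open>K\<close>.\<close>

lemma independence_number_mult_le:
  fixes T :: "'t::finite \<Rightarrow> 't \<Rightarrow> bool" and H :: "'v::finite \<Rightarrow> 'v \<Rightarrow> bool"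
    and K :: "'s::finite \<Rightarrow> 's \<Rightarrow> bool"
  assumes vt: "vertex_transitive T"
    and edge: "\<And>u v. K (g u) (g v) \<Longrightarrow> T (f u) (f v) \<or> H u v"
    and fibre: "\<And>u v. u \<noteq> v \<Longrightarrow> g u = g v \<Longrightarrow> T (f u) (f v) \<or> H u v"
  shows "independence_number T * independence_number H \<le> CARD('t) * independence_number K"
proof -
  obtain I where I: "independent_set T I" "independence_number T = card I"
    by (rule independence_number_attained)
  obtain S where S: "independent_set H S" "independence_number H = card S"
    by (rule independence_number_attained)
  define \<Gamma> where "\<Gamma> = {\<phi>. automorphism T \<phi>}"
  have "id \<in> \<Gamma>" using automorphism_id[of T] by (simp add: \<Gamma>_def)
  then have \<Gamma>: "0 < card \<Gamma>" by (auto simp: card_gt_0_iff)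
  have bound: "card {v \<in> S. f v \<in> \<phi> ` I} \<le> independence_number K" if \<phi>: "\<phi> \<in> \<Gamma>" for \<phi>
  proof -
    let ?R = "{v \<in> S. f v \<in> \<phi> ` I}"
    \<comment> \<open>The image of \<open>I\<close> under \<open>\<phi>\<close> is again independent
      in \<open>T\<close>.\<close>
    have none: "\<not> (T (f u) (f v) \<or> H u v)" if "u \<in> ?R" "v \<in> ?R" for u v
      using that I(1) S(1) \<phi> by (auto simp: independent_set_def \<Gamma>_def automorphism_def)
    have "inj_on g ?R" using none fibre by (meson inj_onI)
    then have "card ?R = card (g ` ?R)" by (simp add: card_image)
    also have "independent_set K (g ` ?R)"
      unfolding independent_set_def using none edge by blast
    then have "card (g ` ?R) \<le> independence_number K" by (rule independence_number_ge)
    finally show ?thesis .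
  qed
  \<comment> \<open>Double counting of triples with \<open>\<phi> i = f v\<close>; injectivity of
    \<open>\<phi>\<close> allows at most one \<open>i\<close> for given \<open>\<phi>\<close> and
    \<open>v\<close>.\<close>
  have count: "(\<Sum>\<phi>\<in>\<Gamma>. card {v \<in> S. f v \<in> \<phi> ` I})
      = (\<Sum>i\<in>I. \<Sum>v\<in>S. card {\<phi>. automorphism T \<phi> \<and> \<phi> i = f v})"
  proof -
    have "card {v \<in> S. f v \<in> \<phi> ` I} = (\<Sum>i\<in>I. \<Sum>v\<in>S. if \<phi> i = f v then 1 else 0)" if "\<phi> \<in> \<Gamma>" for \<phi>
    proof -
      have inj: "inj \<phi>" using that by (simp add: \<Gamma>_def automorphism_def bij_is_inj)
      have "(\<Sum>i\<in>I. if \<phi> i = f v then 1 else 0) = (if f v \<in> \<phi> ` I then 1 else 0 :: nat)" for v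
      proof -
        have "(\<Sum>i\<in>I. if \<phi> i = f v then 1 else 0) = (\<Sum>j\<in>\<phi> ` I. if j = f v then 1 else 0 :: nat)"
          using inj by (subst sum.reindex) (auto intro: inj_on_subset)
        then show ?thesis by simp
      qed
      then have "(\<Sum>v\<in>S. \<Sum>i\<in>I. if \<phi> i = f v then 1 else 0) = card {v \<in> S. f v \<in> \<phi> ` I}"
        by (simp add: sum.If_cases Int_def)
      then show ?thesis by (subst sum.swap) simp
    qed
    then have "(\<Sum>\<phi>\<in>\<Gamma>. card {v \<in> S. f v \<in> \<phi> ` I})
        = (\<Sum>\<phi>\<in>\<Gamma>. \<Sum>i\<in>I. \<Sum>v\<in>S. if \<phi> i = f v then 1 else 0)" by simp
    also have "\<dots> = (\<Sum>i\<in>I. \<Sum>\<phi>\<in>\<Gamma>. \<Sum>v\<in>S. if \<phi> i = f v then 1 else 0)"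
      by (rule sum.swap)
    also have "\<dots> = (\<Sum>i\<in>I. \<Sum>v\<in>S. \<Sum>\<phi>\<in>\<Gamma>. if \<phi> i = f v then 1 else 0)"
      by (intro sum.cong refl sum.swap)
    also have "\<dots> = (\<Sum>i\<in>I. \<Sum>v\<in>S. card {\<phi>. automorphism T \<phi> \<and> \<phi> i = f v})"
      by (simp add: sum.If_cases Int_def \<Gamma>_def)
    finally show ?thesis .
  qed
  have "card I * card S * card \<Gamma> = (\<Sum>i\<in>I. \<Sum>v\<in>S. CARD('t) * card {\<phi>. automorphism T \<phi> \<and> \<phi> i = f v})"
    by (simp add: card_automorphisms_maps_to[OF vt] \<Gamma>_def)
  also have "\<dots> = CARD('t) * (\<Sum>\<phi>\<in>\<Gamma>. card {v \<in> S. f v \<in> \<phi> ` I})"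
    unfolding count by (simp add: sum_distrib_left)
  also have "\<dots> \<le> CARD('t) * (\<Sum>\<phi>\<in>\<Gamma>. independence_number K)"
    using bound by (intro mult_left_mono sum_mono) auto
  finally have "card I * card S * card \<Gamma> \<le> CARD('t) * independence_number K * card \<Gamma>"
    by (simp add: mult_ac)
  then show ?thesis using \<Gamma> by (simp add: I(2) S(2))
qed

subsection \<open>The homomorphic product\<close>

theorem theorem4:
  fixes X :: "'a::finite \<Rightarrow> 'a \<Rightarrow> bool" and Y :: "'b::finite \<Rightarrow> 'b \<Rightarrow> bool"
  assumes "simple_graph X" and "simple_graph Y"
  shows "(vertex_transitive X \<longrightarrow>
      real (independence_number (X \<ltimes> Y))
        \<le> real CARD('a) * (real (independence_number (complement Y))
                             / real (independence_number (complement X))) \<and>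
      theta_S (X \<ltimes> Y) \<le> real CARD('a) * (theta_S (complement Y) / theta_S (complement X)) \<and>
      theta_L (X \<ltimes> Y) \<le> real CARD('a) * (theta_L (complement Y) / theta_L (complement X)) \<and>
      real CARD('a) * (theta_L (complement Y) / theta_L (complement X))
        = theta_L X * theta_L (complement Y)) \<and>
    (vertex_transitive Y \<longrightarrow>
      real (independence_number (X \<ltimes> Y))
        \<le> real CARD('b) * (real (independence_number X) / real (independence_number Y)) \<and>
      theta_S (X \<ltimes> Y) \<le> real CARD('b) * (theta_S X / theta_S Y) \<and>
      theta_L (X \<ltimes> Y) \<le> real CARD('b) * (theta_L X / theta_L Y) \<and>
      real CARD('b) * (theta_L X / theta_L Y) = theta_L X * theta_L (complement Y))"
proof -
  have irr: "irreflp X" "irreflp Y" using assms by (auto simp: simple_graph_def)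
  have irrH: "irreflp (X \<ltimes> Y)" by (simp add: irreflp_def hom_product_def)
  note ic = irreflp_complement
  have alpha: "real a \<le> real n * (real k / real t)" if "t * a \<le> n * k" "0 < t" for a n k t :: nat
  proof -
    have "real t * real a \<le> real n * real k" using that(1) by (metis of_nat_le_iff of_nat_mult)
    then show ?thesis using that(2) by (simp add: field_simps)
  qed
  have theta: "a \<le> n * (k / t)" if "t * a \<le> n * k" "1 \<le> t" for a n k t :: real
    using that by (simp add: field_simps)
  \<comment> \<open>Edge and fibre conditions for \<open>f = fst\<close>,
    \<open>g = snd\<close>.\<close>
  have eX: "complement X (fst p) (fst q) \<or> (X \<ltimes> Y) p q" if "complement Y (snd p) (snd q)" for p q
    using that by (auto simp: complement_def hom_product_def)
  \<comment> \<open>Here the first coordinates differ: if they are adjacent in \<open>X\<close>,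
    irreflexivity of \<open>Y\<close> gives a product edge.\<close>
  have fX: "complement X (fst p) (fst q) \<or> (X \<ltimes> Y) p q" if "p \<noteq> q" "snd p = snd q" for p q
    using that irr(2) by (auto simp: complement_def hom_product_def irreflp_def)
  \<comment> \<open>The same conditions with the projections exchanged.\<close>
  have eY: "Y (snd p) (snd q) \<or> (X \<ltimes> Y) p q" if "X (fst p) (fst q)" for p q
    using that irr(1) by (auto simp: hom_product_def irreflp_def)
  have fY: "Y (snd p) (snd q) \<or> (X \<ltimes> Y) p q" if "p \<noteq> q" "fst p = fst q" for p q
    using that by (auto simp: hom_product_def)
  show ?thesis
  proof (intro conjI impI)
    assume vt: "vertex_transitive X"
    note vtc = vertex_transitive_complement[OF vt]
    show "real (independence_number (X \<ltimes> Y))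
        \<le> real CARD('a) * (real (independence_number (complement Y))
                             / real (independence_number (complement X)))"
      by (intro alpha independence_number_mult_le[OF vtc eX fX] independence_number_pos ic)
    show "theta_S (X \<ltimes> Y) \<le> real CARD('a) * (theta_S (complement Y) / theta_S (complement X))"
      by (intro theta theta_S_mult_le[OF vtc ic irrH ic eX fX] theta_S_ge_1 ic)
    show "theta_L (X \<ltimes> Y) \<le> real CARD('a) * (theta_L (complement Y) / theta_L (complement X))"
      by (intro theta theta_L_mult_le[OF vtc ic irrH ic eX fX] theta_L_ge_1 ic)
    show "real CARD('a) * (theta_L (complement Y) / theta_L (complement X))
        = theta_L X * theta_L (complement Y)"
      using theta_L_mult_theta_L_complement[OF assms(1) vt] theta_L_ge_1[OF ic, of X]
      by (simp add: field_simps)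
  next
    assume vt: "vertex_transitive Y"
    show "real (independence_number (X \<ltimes> Y))
        \<le> real CARD('b) * (real (independence_number X) / real (independence_number Y))"
      by (intro alpha independence_number_mult_le[OF vt eY fY] independence_number_pos irr)
    show "theta_S (X \<ltimes> Y) \<le> real CARD('b) * (theta_S X / theta_S Y)"
      by (intro theta theta_S_mult_le[OF vt irr(2) irrH irr(1) eY fY] theta_S_ge_1 irr)
    show "theta_L (X \<ltimes> Y) \<le> real CARD('b) * (theta_L X / theta_L Y)"
      by (intro theta theta_L_mult_le[OF vt irr(2) irrH irr(1) eY fY] theta_L_ge_1 irr)
    show "real CARD('b) * (theta_L X / theta_L Y) = theta_L X * theta_L (complement Y)"
      using theta_L_mult_theta_L_complement[OF assms(2) vt] theta_L_ge_1[OF irr(2)]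
      by (simp add: field_simps)
  qed
qed

end
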